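(* For every real $r\in(0,1/4]$ there exists a constant $c'_r\in\mathbb{R}$ (depending only on $r$) such that for every integer $d\geq 2$, \[N(r,d)\leq c'_r\log d.\] In particular, $c'_r$ can be taken to be \[c'_r=q^{q^2+2}(4\log q+1),\qquad\text{where } q=\lceil 1/r\rceil .\]
   Context: Here $\log$ denotes the natural logarithm. For an integer $d\ge 2$, let $\mathscr{B}_d$ be the family of all open axis-parallel boxes $B=I_1\times\cdots\times I_d\subseteq[0,1]^d$, where each $I_i$ is an open interval; the volume is $\operatorname{vol}(B)=|I_1|\cdots|I_d|$, where $|I_i|$ is the length of $I_i$. For a finite set $T\subset[0,1]^d$, the dispersion of $T$ is \[\operatorname{disp}(T)=\sup_{B\in\mathscr{B}_d,\ B\cap T=\emptyset}\operatorname{vol}(B).\] The minimal dispersion is \[\operatorname{disp}^*(n,d)=\inf_{T\subset[0,1]^d,\ |T|=n}\operatorname{disp}(T),\] and for $r\in(0,1)$ its inverse function is \[N(r,d)=\min\{n\in\mathbb{N}:\operatorname{disp}^*(n,d)\leq r\}.\] *)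

theory Defs
  imports Complex_Main "HOL-Library.FuncSet"
begin

text \<open>
  A point of \<open>\<real>\<^sup>d\<close> is a function on \<open>{..<d}\<close>, extended by \<open>undefined\<close> outside
  (\<open>PiE\<close>). Equal points are thus equal functions, so \<open>card\<close> counts points correctly, and the
  dimension \<open>d\<close> can be quantified over.
\<close>

definition unit_cube :: "nat \<Rightarrow> (nat \<Rightarrow> real) set" where
  "unit_cube d = {..<d} \<rightarrow>\<^sub>E {0..1}"

definition open_box :: "nat \<Rightarrow> (nat \<Rightarrow> real) \<Rightarrow> (nat \<Rightarrow> real) \<Rightarrow> (nat \<Rightarrow> real) set" where
  "open_box d a b = (\<Pi>\<^sub>E i\<in>{..<d}. {a i<..<b i})"

definition box_vol :: "nat \<Rightarrow> (nat \<Rightarrow> real) \<Rightarrow> (nat \<Rightarrow> real) \<Rightarrow> real" where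
  "box_vol d a b = (\<Prod>i<d. b i - a i)"

lemma open_box_subset_unit_cube_iff:
  assumes "\<And>i. i < d \<Longrightarrow> a i < b i"
  shows "open_box d a b \<subseteq> unit_cube d \<longleftrightarrow> (\<forall>i<d. 0 \<le> a i \<and> b i \<le> 1)"
proof
  assume sub: "open_box d a b \<subseteq> unit_cube d"
  have in01: "y \<in> {0..1}" if "i < d" and "a i < y" "y < b i" for i y
  proof -
    define x where "x = (\<lambda>j\<in>{..<d}. if j = i then y else (a j + b j) / 2)"
    have "x \<in> open_box d a b"
      using assms that unfolding x_def open_box_def by (auto simp: field_simps)
    with sub have "x i \<in> {0..1}"
      using \<open>i < d\<close> unfolding unit_cube_def by (blast dest: PiE_mem)
    then show ?thesis
      using \<open>i < d\<close> unfolding x_def by simp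
  qed
  show "\<forall>i<d. 0 \<le> a i \<and> b i \<le> 1"
  proof (intro allI impI conjI)
    fix i assume i: "i < d"
    show "0 \<le> a i"
    proof (rule ccontr)
      assume "\<not> 0 \<le> a i"
      then have "a i < min 0 (b i)" using assms[OF i] by simp
      then obtain y where "a i < y" "y < min 0 (b i)" using dense by blast
      then show False using in01[OF i, of y] by simp
    qed
    show "b i \<le> 1"
    proof (rule ccontr)
      assume "\<not> b i \<le> 1"
      then have "max 1 (a i) < b i" using assms[OF i] by simp
      then obtain y where "max 1 (a i) < y" "y < b i" using dense by blast
      then show False using in01[OF i, of y] by simp
    qed
  qed
next
  assume "\<forall>i<d. 0 \<le> a i \<and> b i \<le> 1"
  then show "open_box d a b \<subseteq> unit_cube d"
    unfolding open_box_def unit_cube_def by (intro PiE_mono) force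
qed

text \<open>
  Boxes are given by the endpoints of their sides, which are nonempty. By \<open>disp_set_bdd_above\<close>,
  \<open>disp_set_nonempty\<close>, \<open>min_disp_set_bdd_below\<close>, \<open>min_disp_set_nonempty\<close> and
  \<open>ex_min_disp_le\<close> below, for \<open>d \<ge> 1\<close>, finite \<open>T\<close> and \<open>r > 0\<close> the supremum, the infimum and the
  minimum in the following definitions are genuine and never take a default value.
\<close>

definition disp :: "nat \<Rightarrow> (nat \<Rightarrow> real) set \<Rightarrow> real" where
  "disp d T = Sup {box_vol d a b | a b.
     (\<forall>i<d. a i < b i) \<and> open_box d a b \<subseteq> unit_cube d \<and> open_box d a b \<inter> T = {}}"

lemma box_vol_le_1:
  assumes "\<And>i. i < d \<Longrightarrow> a i < b i" and "open_box d a b \<subseteq> unit_cube d"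
  shows "box_vol d a b \<le> 1"
proof -
  have "\<forall>i<d. 0 \<le> a i \<and> b i \<le> 1"
    using open_box_subset_unit_cube_iff[of d a b] assms by blast
  then have "0 \<le> b i - a i \<and> b i - a i \<le> 1" if "i < d" for i
    using that assms(1)[OF that] by (smt (verit))
  then show ?thesis
    unfolding box_vol_def by (intro prod_le_1) simp
qed

lemma disp_set_bdd_above:
  "bdd_above {box_vol d a b | a b.
     (\<forall>i<d. a i < b i) \<and> open_box d a b \<subseteq> unit_cube d \<and> open_box d a b \<inter> T = {}}"
  by (rule bdd_aboveI[of _ 1]) (auto intro: box_vol_le_1)

lemma disp_set_nonempty:
  assumes "d \<ge> 1" and "finite T"
  shows "{box_vol d a b | a b.
     (\<forall>i<d. a i < b i) \<and> open_box d a b \<subseteq> unit_cube d \<and> open_box d a b \<inter> T = {}} \<noteq> {}"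
proof -
  define S where "S = insert 1 {x 0 | x. x \<in> T \<and> 0 < x 0}"
  have fin: "finite S" using assms(2) unfolding S_def by simp
  define m :: real where "m = Min S"
  have "m > 0" using fin unfolding m_def by (subst Min_gr_iff) (auto simp: S_def)
  have "m \<le> 1" unfolding m_def using fin by (intro Min_le) (auto simp: S_def)
  have *: "open_box d (\<lambda>_. 0) (\<lambda>_. m) \<inter> T = {}"
  proof (rule ccontr)
    assume "open_box d (\<lambda>_. 0) (\<lambda>_. m) \<inter> T \<noteq> {}"
    then obtain x where x: "x \<in> open_box d (\<lambda>_. 0) (\<lambda>_. m)" "x \<in> T" by blast
    have "0 < x 0 \<and> x 0 < m"
      using PiE_mem[OF x(1)[unfolded open_box_def], of 0] assms(1) by simp
    moreover have "m \<le> x 0" if "0 < x 0"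
      unfolding m_def using fin x that by (intro Min_le) (auto simp: S_def)
    ultimately show False by simp
  qed
  have "open_box d (\<lambda>_. 0) (\<lambda>_. m) \<subseteq> unit_cube d"
    using \<open>m > 0\<close> \<open>m \<le> 1\<close> by (subst open_box_subset_unit_cube_iff) auto
  then have "(\<forall>i<d. 0 < m) \<and> open_box d (\<lambda>_. 0) (\<lambda>_. m) \<subseteq> unit_cube d \<and>
      open_box d (\<lambda>_. 0) (\<lambda>_. m) \<inter> T = {}"
    using * \<open>m > 0\<close> by simp
  then have "box_vol d (\<lambda>_. 0) (\<lambda>_. m) \<in> {box_vol d a b | a b.
      (\<forall>i<d. a i < b i) \<and> open_box d a b \<subseteq> unit_cube d \<and> open_box d a b \<inter> T = {}}"
    by (intro CollectI exI[of _ "\<lambda>_. 0"] exI[of _ "\<lambda>_. m"]) simp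
  then show ?thesis by (metis empty_iff)
qed

lemma disp_nonneg:
  assumes "d \<ge> 1" and "finite T"
  shows "disp d T \<ge> 0"
proof -
  obtain a b where ab: "\<forall>i<d. a i < b i" "open_box d a b \<subseteq> unit_cube d"
      "open_box d a b \<inter> T = {}"
    using disp_set_nonempty[OF assms] by blast
  have "0 \<le> box_vol d a b"
    unfolding box_vol_def using ab(1) by (intro prod_nonneg) (auto simp: less_imp_le)
  also have "\<dots> \<le> disp d T"
    unfolding disp_def using ab by (intro cSup_upper disp_set_bdd_above) blast
  finally show ?thesis .
qed

definition min_disp :: "nat \<Rightarrow> nat \<Rightarrow> real" where
  "min_disp n d = Inf {disp d T | T. T \<subseteq> unit_cube d \<and> finite T \<and> card T = n}"

lemma min_disp_set_bdd_below:
  assumes "d \<ge> 1"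
  shows "bdd_below {disp d T | T. T \<subseteq> unit_cube d \<and> finite T \<and> card T = n}"
  using disp_nonneg[OF assms] by (intro bdd_belowI[of _ 0]) auto

lemma min_disp_set_nonempty:
  assumes "d \<ge> 1"
  shows "{disp d T | T. T \<subseteq> unit_cube d \<and> finite T \<and> card T = n} \<noteq> {}"
proof -
  define f where "f = (\<lambda>x::real. \<lambda>i\<in>{..<d}. x)"
  have "inj_on f {0..1}"
    using assms unfolding f_def by (intro inj_onI) (auto dest!: fun_cong[of _ _ 0])
  then have "infinite (f ` {0..1})"
    using finite_image_iff[of f "{0..1}"] infinite_Icc[of 0 "1::real"] by simp
  moreover have "f ` {0..1} \<subseteq> unit_cube d"
    unfolding f_def unit_cube_def by (auto split: if_splits)
  ultimately have "infinite (unit_cube d)"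
    using finite_subset by blast
  then obtain T where "finite T" "card T = n" "T \<subseteq> unit_cube d"
    using infinite_arbitrarily_large[of "unit_cube d" n] by blast
  then have "disp d T \<in> {disp d T | T. T \<subseteq> unit_cube d \<and> finite T \<and> card T = n}"
    by blast
  then show ?thesis by (metis empty_iff)
qed

lemma ex_min_disp_le:
  assumes "d \<ge> 1" and "r > 0"
  shows "\<exists>n. min_disp n d \<le> r"
proof -
  obtain m :: nat where m: "0 < m" "1 / real m < r"
    using reals_Archimedean[OF assms(2)]
    by (metis inverse_eq_divide of_nat_Suc zero_less_Suc)
  define T where "T = {..<d} \<rightarrow>\<^sub>E (\<lambda>k. real k / real m) ` {..m}"
  have fin: "finite T" unfolding T_def by (intro finite_PiE) auto
  have sub: "T \<subseteq> unit_cube d"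
    unfolding T_def unit_cube_def using m by (intro PiE_mono) auto
  have "disp d T \<le> r"
    unfolding disp_def
  proof (rule cSup_least[OF disp_set_nonempty[OF assms(1) fin]])
    fix v assume "v \<in> {box_vol d a b | a b.
      (\<forall>i<d. a i < b i) \<and> open_box d a b \<subseteq> unit_cube d \<and> open_box d a b \<inter> T = {}}"
    then obtain a b where v: "v = box_vol d a b" and ab: "\<forall>i<d. a i < b i"
        "open_box d a b \<subseteq> unit_cube d" "open_box d a b \<inter> T = {}"
      by blast
    have bnd: "\<forall>i<d. 0 \<le> a i \<and> b i \<le> 1"
      using ab open_box_subset_unit_cube_iff by blast
    have "\<exists>i<d. b i - a i \<le> r"
    proof (rule ccontr)
      assume "\<not> (\<exists>i<d. b i - a i \<le> r)"
      then have long: "b i - a i > 1 / real m" if "i < d" for i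
        using that m(2) by force
      define k where "k i = nat (\<lfloor>a i * real m\<rfloor> + 1)" for i
      have k: "a i < real (k i) / real m" "real (k i) / real m < b i" "k i \<le> m"
        if i: "i < d" for i
      proof -
        have "0 \<le> a i * real m" using bnd i by simp
        then have rk: "real (k i) = of_int \<lfloor>a i * real m\<rfloor> + 1" unfolding k_def by simp
        then have lo: "a i * real m < real (k i)" and hi: "real (k i) \<le> a i * real m + 1"
          by linarith+
        show "a i < real (k i) / real m" using lo m(1) by (simp add: field_simps)
        have "a i * real m + 1 < b i * real m" using long[OF i] m(1) by (simp add: field_simps)
        with hi have *: "real (k i) < b i * real m" by linarith
        then show "real (k i) / real m < b i" using m(1) by (simp add: field_simps)
        have "b i * real m \<le> real m" using bnd i mult_right_mono[of "b i" 1 "real m"] by simp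
        with * show "k i \<le> m" by linarith
      qed
      have "(\<lambda>i\<in>{..<d}. real (k i) / real m) \<in> open_box d a b \<inter> T"
        unfolding open_box_def T_def
        by (intro IntI restrict_PiE_iff[THEN iffD2] ballI imageI) (simp_all add: k)
      with ab(3) show False by blast
    qed
    then obtain i where i: "i < d" "b i - a i \<le> r" by blast
    have "box_vol d a b = (b i - a i) * (\<Prod>j\<in>{..<d} - {i}. b j - a j)"
      unfolding box_vol_def using i(1) by (intro prod.remove) auto
    also have "\<dots> \<le> (b i - a i) * 1"
    proof (rule mult_left_mono)
      have "0 \<le> b j - a j \<and> b j - a j \<le> 1" if "j < d" for j
        using ab(1) bnd that by (smt (verit))
      then show "(\<Prod>j\<in>{..<d} - {i}. b j - a j) \<le> 1"
        by (intro prod_le_1) simp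
      show "0 \<le> b i - a i" using ab(1) i(1) by (simp add: less_imp_le)
    qed
    finally show "v \<le> r" using v i(2) by simp
  qed
  moreover have "min_disp (card T) d \<le> disp d T"
    unfolding min_disp_def using sub fin
    by (intro cInf_lower min_disp_set_bdd_below[OF assms(1)]) blast
  ultimately show ?thesis by (meson order_trans)
qed

definition inv_min_disp :: "real \<Rightarrow> nat \<Rightarrow> nat" where
  "inv_min_disp r d = (LEAST n. min_disp n d \<le> r)"

end

theory Submission
  imports Defs
begin

text \<open>
  Let \<open>q = \<lceil>1/r\<rceil>\<close> and consider points with all coordinates in \<open>{1/q, \<dots>, (q-1)/q}\<close>. If a box has
  volume more than \<open>1/q\<close>, each of its sides contains such a coordinate, and all but at most \<open>q\<^sup>2\<close>
  sides have length more than \<open>1 - 1/q\<close> and so contain all of them. Thus it suffices that the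
  point set realises every pattern on every \<open>q\<^sup>2\<close> coordinates. There are at most
  \<open>(d (q-1)) ^ q\<^sup>2\<close> patterns and each is realised by a fraction of at least \<open>(q-1) ^ -q\<^sup>2\<close> of the
  grid, so picking greedily a grid point that realises the most remaining patterns succeeds
  after \<open>O(log d)\<close> steps.
\<close>

section \<open>Universal point sets by greedy selection\<close>

text \<open>Some point lies in at least a fraction \<open>p\<close> of the remaining sets, so each
  pick multiplies their number by at most \<open>1 - p\<close>. After \<open>n\<close> picks fewer
  than one set, hence none, is left.\<close>

lemma greedy_hitting_set:
  fixes p :: real
  assumes "finite G" "G \<noteq> {}" "finite F" "p \<le> 1"
    and "\<And>C. C \<in> F \<Longrightarrow> C \<subseteq> G \<and> p * real (card G) \<le> real (card C)"
    and "real (card F) * (1 - p) ^ n < 1"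
  shows "\<exists>T\<subseteq>G. finite T \<and> card T \<le> n \<and> (\<forall>C\<in>F. C \<inter> T \<noteq> {})"
  using assms(3,5,6)
proof (induction n arbitrary: F)
  case 0
  then have "F = {}" by simp
  then show ?case by (intro exI[of _ "{}"]) simp
next
  case (Suc n)
  have "\<exists>x\<in>G. p * real (card F) \<le> real (card {C \<in> F. x \<in> C})"
  proof (rule ccontr)
    assume "\<not> ?thesis"
    \<comment> \<open>Double counting of the incidences between points and sets: if every point fell
      short of the fraction \<open>p\<close>, the sets would be too small on average.\<close>
    then have "(\<Sum>x\<in>G. real (card {C \<in> F. x \<in> C})) < (\<Sum>x\<in>G. p * real (card F))"
      using assms(1,2) by (intro sum_strict_mono) auto
    also have "\<dots> = (\<Sum>C\<in>F. p * real (card G))" by simp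
    also have "\<dots> \<le> (\<Sum>C\<in>F. real (card C))"
      using Suc.prems(2) by (intro sum_mono) auto
    also have "\<dots> = (\<Sum>C\<in>F. \<Sum>x\<in>G. if x \<in> C then 1 else 0)"
    proof (intro sum.cong refl)
      fix C assume "C \<in> F"
      then have "G \<inter> C = C" using Suc.prems(2) by blast
      then show "real (card C) = (\<Sum>x\<in>G. if x \<in> C then 1 else 0)"
        using assms(1) by (simp add: sum.If_cases Int_def)
    qed
    also have "\<dots> = (\<Sum>x\<in>G. \<Sum>C\<in>F. if x \<in> C then 1 else 0)" by (rule sum.swap)
    also have "\<dots> = (\<Sum>x\<in>G. real (card {C \<in> F. x \<in> C}))"
      using Suc.prems(1) by (simp add: sum.If_cases Int_def)
    finally show False by simp
  qed
  then obtain x where x: "x \<in> G" "p * real (card F) \<le> real (card {C \<in> F. x \<in> C})" by blast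
  let ?F = "{C \<in> F. x \<notin> C}"
  have "card F = card {C \<in> F. x \<in> C} + card ?F"
    using Suc.prems(1) by (subst card_Un_disjoint[symmetric]) (auto intro: arg_cong[of _ _ card])
  then have "real (card ?F) \<le> real (card F) * (1 - p)"
    using x(2) by (simp add: algebra_simps)
  then have "real (card ?F) * (1 - p) ^ n \<le> real (card F) * (1 - p) * (1 - p) ^ n"
    using assms(4) by (intro mult_right_mono) auto
  also have "\<dots> < 1" using Suc.prems(3) by (simp add: mult.assoc)
  finally obtain T where T: "T \<subseteq> G" "finite T" "card T \<le> n" "\<forall>C\<in>?F. C \<inter> T \<noteq> {}"
    using Suc.IH[of ?F] Suc.prems(1,2) by auto
  show ?case
    using T x(1) by (intro exI[of _ "insert x T"]) (auto simp: card_insert_if)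
qed

text \<open>The sets to be hit are the cylinders of the grid cut out by \<open>K\<close> pairs of a
  coordinate and a value. Since \<open>s\<close> may repeat coordinates, patterns on fewer than
  \<open>K\<close> coordinates are covered too, also when \<open>d < K\<close>.\<close>

lemma ex_universal_set:
  fixes V :: "'a set"
  assumes V: "finite V" "V \<noteq> {}"
    and n: "real ((d * card V) ^ K) * (1 - 1 / real (card V) ^ K) ^ n < 1"
  shows "\<exists>T\<subseteq>{..<d} \<rightarrow>\<^sub>E V. finite T \<and> card T \<le> n \<and>
    (\<forall>s\<in>{..<K} \<rightarrow> {..<d}. \<forall>w\<in>{..<d} \<rightarrow> V. \<exists>x\<in>T. \<forall>j<K. x (s j) = w (s j))"
proof -
  define G where "G = {..<d} \<rightarrow>\<^sub>E V"
  define U where "U = {..<K} \<rightarrow>\<^sub>E {..<d} \<times> V"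
  define cyl where "cyl u = {x \<in> G. \<forall>j<K. x (fst (u j)) = snd (u j)}" for u :: "nat \<Rightarrow> nat \<times> 'a"
  \<comment> \<open>A tuple giving two values to one coordinate has an empty cylinder, which no
    point can hit.\<close>
  define F where "F = cyl ` U - {{}}"
  have m: "card V \<ge> 1" using V by (simp add: Suc_le_eq card_gt_0_iff)
  have finG: "finite G" unfolding G_def using V by (simp add: finite_PiE)
  have finU: "finite U" unfolding U_def using V by (simp add: finite_PiE)
  have "card U = (d * card V) ^ K"
    unfolding U_def by (simp add: card_PiE card_cartesian_product)
  moreover have "card F \<le> card U"
    unfolding F_def using finU by (meson Diff_subset card_image_le card_mono finite_imageI le_trans)
  ultimately have cardF: "card F \<le> (d * card V) ^ K" by simp
  have "\<exists>T\<subseteq>G. finite T \<and> card T \<le> n \<and> (\<forall>C\<in>F. C \<inter> T \<noteq> {})"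
  proof (rule greedy_hitting_set[OF finG])
    show "G \<noteq> {}" unfolding G_def using V by (simp add: PiE_eq_empty_iff)
    show "finite F" unfolding F_def using finU by simp
    show p: "1 / real (card V) ^ K \<le> 1" using m by simp
    have "real (card F) * (1 - 1 / real (card V) ^ K) ^ n
        \<le> real ((d * card V) ^ K) * (1 - 1 / real (card V) ^ K) ^ n"
      using cardF p by (intro mult_right_mono of_nat_mono) auto
    then show "real (card F) * (1 - 1 / real (card V) ^ K) ^ n < 1" using n by linarith
  next
    fix C assume "C \<in> F"
    then obtain u w where u: "u \<in> U" "C = cyl u" and w: "w \<in> C" unfolding F_def by auto
    \<comment> \<open>The tuple \<open>u\<close> may name a coordinate twice, so only the distinct
      ones in \<open>S\<close> count, at most \<open>K\<close> of them. The member \<open>w\<close>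
      of \<open>C\<close> supplies the prescribed values.\<close>
    define S where "S = (\<lambda>j. fst (u j)) ` {..<K}"
    have "S \<subseteq> {..<d}" using u(1) unfolding S_def U_def by (auto dest!: PiE_mem)
    have "card S \<le> K" unfolding S_def using card_image_le[of "{..<K}"] by fastforce
    have wG: "w \<in> G" and wu: "\<And>j. j < K \<Longrightarrow> snd (u j) = w (fst (u j))"
      using w u(2) unfolding cyl_def by auto
    have "C = (\<Pi>\<^sub>E i\<in>{..<d}. if i \<in> S then {w i} else V)"
    proof -
      have "C = {x \<in> G. \<forall>i\<in>S. x i = w i}"
        unfolding u(2) cyl_def S_def using wu by auto
      also have "\<dots> = (\<Pi>\<^sub>E i\<in>{..<d}. if i \<in> S then {w i} else V)"
        using wG \<open>S \<subseteq> {..<d}\<close> unfolding G_def by (fastforce simp: PiE_iff split: if_splits)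
      finally show ?thesis .
    qed
    then have "card C = (\<Prod>i<d. if i \<in> S then 1 else card V)"
      by (simp add: card_PiE if_distrib cong: if_cong)
    also have "\<dots> = card V ^ card ({..<d} - S)"
      by (simp add: prod.If_cases Diff_eq)
    also have "card ({..<d} - S) = d - card S"
      using \<open>S \<subseteq> {..<d}\<close> by (simp add: card_Diff_subset finite_subset)
    finally have C: "card C = card V ^ (d - card S)" .
    have "card S \<le> d" using card_mono[OF _ \<open>S \<subseteq> {..<d}\<close>] by simp
    \<comment> \<open>Fixing the coordinates in \<open>S\<close> divides the size of the grid by
      \<open>card V ^ card S\<close>, which is at most \<open>card V ^ K\<close>.\<close>
    have "card G = card V ^ (d - card S) * card V ^ card S"
      unfolding G_def using \<open>card S \<le> d\<close> by (simp add: card_PiE flip: power_add)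
    also have "\<dots> \<le> card C * card V ^ K"
      unfolding C using m \<open>card S \<le> K\<close> by (intro mult_left_mono power_increasing) auto
    finally have "real (card G) \<le> real (card C) * real (card V) ^ K"
      by (metis of_nat_le_iff of_nat_mult of_nat_power)
    then show "C \<subseteq> G \<and> 1 / real (card V) ^ K * real (card G) \<le> real (card C)"
      using m u(2) by (auto simp: cyl_def field_simps)
  qed
  then obtain T where T: "T \<subseteq> G" "finite T" "card T \<le> n" "\<forall>C\<in>F. C \<inter> T \<noteq> {}" by blast
  have "\<exists>x\<in>T. \<forall>j<K. x (s j) = w (s j)"
    if s: "s \<in> {..<K} \<rightarrow> {..<d}" and w: "w \<in> {..<d} \<rightarrow> V" for s w
  proof -
    define u where "u = (\<lambda>j\<in>{..<K}. (s j, w (s j)))"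
    have "u \<in> U" unfolding u_def U_def using s w by (auto simp: Pi_iff)
    moreover have "restrict w {..<d} \<in> cyl u"
      using s w unfolding cyl_def u_def G_def by (auto simp: Pi_iff)
    ultimately have "cyl u \<in> F" unfolding F_def by auto
    then obtain x where "x \<in> T" "x \<in> cyl u" using T(4) by blast
    then show ?thesis unfolding cyl_def u_def by (intro bexI[of _ x]) auto
  qed
  then show ?thesis using T(1-3) unfolding G_def by blast
qed

section \<open>Boxes of large volume and the grid\<close>

text \<open>More than \<open>q\<^sup>2\<close> factors of size at most 1 - 1/q would push the
  product down to (1 - 1/q)^(q^2) \<le> exp(-q) \<le> 1/q.\<close>

lemma prod_one_minus_inverse_bound:
  fixes l :: "'a \<Rightarrow> real" and q :: nat
  assumes "finite I" "q \<ge> 1" "\<And>i. i \<in> I \<Longrightarrow> 0 \<le> l i \<and> l i \<le> 1"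
    and "1 / real q < (\<Prod>i\<in>I. l i)"
  shows "card {i \<in> I. l i \<le> 1 - 1 / real q} \<le> q\<^sup>2"
proof (rule ccontr)
  let ?S = "{i \<in> I. l i \<le> 1 - 1 / real q}"
  assume "\<not> card ?S \<le> q\<^sup>2"
  then have k: "q\<^sup>2 \<le> card ?S" by simp
  have "(\<Prod>i\<in>I. l i) = (\<Prod>i\<in>I - ?S. l i) * (\<Prod>i\<in>?S. l i)"
    using assms(1) by (intro prod.subset_diff) auto
  also have "\<dots> \<le> 1 * (\<Prod>i\<in>?S. 1 - 1 / real q)"
    using assms(2,3) by (intro mult_mono prod_le_1 prod_mono prod_nonneg) auto
  also have "\<dots> = (1 - 1 / real q) ^ card ?S" by simp
  also have "\<dots> \<le> (1 - 1 / real q) ^ q\<^sup>2"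
    using assms(2) k by (intro power_decreasing) auto
  also have "\<dots> \<le> exp (- (1 / real q)) ^ q\<^sup>2"
    using assms(2) exp_ge_add_one_self[of "- (1 / real q)"] by (intro power_mono) auto
  also have "\<dots> = exp (- real q)"
    using assms(2) by (simp flip: exp_of_nat_mult add: power2_eq_square)
  also have "\<dots> \<le> 1 / real q"
  proof -
    have "real q \<le> exp (real q)" using exp_ge_add_one_self[of "real q"] by linarith
    then show ?thesis
      using assms(2) unfolding exp_minus inverse_eq_divide by (intro divide_left_mono) auto
  qed
  finally show False using assms(4) by simp
qed

lemma ex_grid_point_between:
  fixes a b :: real and q :: nat
  assumes "q \<ge> 1" "0 \<le> a" "b \<le> 1" "1 / real q < b - a"
  shows "\<exists>k\<in>{1..<q}. a < real k / real q \<and> real k / real q < b"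
proof -
  \<comment> \<open>The least integer strictly above \<open>a * real q\<close>; adding 1 to the
    floor skips a grid point equal to \<open>a\<close>, which the open interval misses.\<close>
  define k where "k = nat (\<lfloor>a * real q\<rfloor> + 1)"
  have "0 \<le> a * real q" using assms by simp
  then have "real k = of_int \<lfloor>a * real q\<rfloor> + 1" unfolding k_def by simp
  then have lo: "a * real q < real k" and hi: "real k \<le> a * real q + 1" by linarith+
  have "a * real q + 1 < b * real q" using assms by (simp add: field_simps)
  with hi have kb: "real k < b * real q" by linarith
  moreover have "b * real q \<le> real q" using assms mult_right_mono[of b 1 "real q"] by simp
  ultimately have "k < q" by linarith
  moreover have "k \<ge> 1" using lo \<open>0 \<le> a * real q\<close> by linarith
  ultimately show ?thesis using lo kb assms(1) by (intro bexI[of _ k]) (auto simp: field_simps)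
qed

text \<open>The values 0 and 1 are left out, since an open interval inside [0,1] contains neither,
  however long it is.\<close>

definition grid :: "nat \<Rightarrow> real set" where
  "grid q = (\<lambda>k. real k / real q) ` {1..<q}"

lemma card_grid: "card (grid q) = q - 1"
  unfolding grid_def by (subst card_image) (auto intro!: inj_onI)

lemma disp_universal_set_le:
  assumes d: "d \<ge> 1" and q: "q \<ge> 1"
    and T: "T \<subseteq> {..<d} \<rightarrow>\<^sub>E grid q" "finite T"
    and univ: "\<And>s w. s \<in> {..<q\<^sup>2} \<rightarrow> {..<d} \<Longrightarrow> w \<in> {..<d} \<rightarrow> grid q \<Longrightarrow>
      \<exists>x\<in>T. \<forall>j<q\<^sup>2. x (s j) = w (s j)"
  shows "disp d T \<le> 1 / real q"
  unfolding disp_def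
proof (rule cSup_least[OF disp_set_nonempty[OF d T(2)]], rule ccontr)
  fix v assume "v \<in> {box_vol d a b | a b.
    (\<forall>i<d. a i < b i) \<and> open_box d a b \<subseteq> unit_cube d \<and> open_box d a b \<inter> T = {}}"
  then obtain a b where v: "v = box_vol d a b" and ab: "\<forall>i<d. a i < b i"
      "open_box d a b \<subseteq> unit_cube d" "open_box d a b \<inter> T = {}"
    by blast
  assume "\<not> v \<le> 1 / real q"
  then have vol: "1 / real q < (\<Prod>i<d. b i - a i)" unfolding v box_vol_def by simp
  have bnd: "0 \<le> a i" "b i \<le> 1" "a i < b i" if "i < d" for i
    using ab open_box_subset_unit_cube_iff[of d a b] that by blast+
  have len: "0 \<le> b i - a i \<and> b i - a i \<le> 1" if "i < d" for i
    using bnd[OF that] by linarith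
  define S where "S = {i \<in> {..<d}. b i - a i \<le> 1 - 1 / real q}"
  have "finite S" unfolding S_def by simp
  have "card S \<le> q\<^sup>2"
    unfolding S_def using q len vol by (intro prod_one_minus_inverse_bound) auto
  \<comment> \<open>The other sides have length at most 1, so no side is shorter than the volume,
    which exceeds 1/q.\<close>
  have "\<exists>y\<in>grid q. a i < y \<and> y < b i" if i: "i < d" for i
  proof -
    have "(\<Prod>i<d. b i - a i) = (b i - a i) * (\<Prod>j\<in>{..<d} - {i}. b j - a j)"
      using i by (intro prod.remove) auto
    also have "\<dots> \<le> (b i - a i) * 1"
      using len i by (intro mult_left_mono prod_le_1) auto
    finally have "1 / real q < b i - a i" using vol by simp
    then show ?thesis
      using ex_grid_point_between[OF q bnd(1)[OF i] bnd(2)[OF i]] unfolding grid_def by auto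
  qed
  then obtain w where w: "\<And>i. i < d \<Longrightarrow> w i \<in> grid q \<and> a i < w i \<and> w i < b i" by metis
  obtain h where h: "bij_betw h {..<card S} S"
    using ex_bij_betw_nat_finite[OF \<open>finite S\<close>] by (auto simp: lessThan_atLeast0)
  \<comment> \<open>The enumeration of \<open>S\<close> is padded to \<open>q\<^sup>2\<close>
    entries with coordinate 0, which exists because \<open>d \<ge> 1\<close>.\<close>
  define s where "s j = (if j < card S then h j else 0)" for j
  have "h j < d" if "j < card S" for j
    using bij_betwE[OF h] that unfolding S_def by auto
  then have "s \<in> {..<q\<^sup>2} \<rightarrow> {..<d}" using d unfolding s_def by auto
  moreover have "w \<in> {..<d} \<rightarrow> grid q" using w by auto
  ultimately obtain x where x: "x \<in> T" "\<forall>j<q\<^sup>2. x (s j) = w (s j)"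
    using univ[of s w] by blast
  have xS: "x i = w i" if "i \<in> S" for i
  proof -
    have "i \<in> h ` {..<card S}" using bij_betw_imp_surj_on[OF h] that by simp
    then obtain j where j: "j < card S" "i = h j" by (elim imageE) simp
    then have "j < q\<^sup>2" using \<open>card S \<le> q\<^sup>2\<close> by linarith
    then have "x (s j) = w (s j)" using x(2) by blast
    then show ?thesis using j unfolding s_def by simp
  qed
  have xG: "x \<in> {..<d} \<rightarrow>\<^sub>E grid q" using x(1) T(1) by blast
  have "a i < x i \<and> x i < b i" if i: "i < d" for i
  proof (cases "i \<in> S")
    case True
    then show ?thesis using w[OF i] xS by simp
  next
    case False
    then have long: "1 - 1 / real q < b i - a i" using i unfolding S_def by simp
    have "x i \<in> grid q" using xG i by auto
    then obtain k where k: "1 \<le> k" "k < q" "x i = real k / real q" unfolding grid_def by auto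
    have "real k \<le> real q - 1" using k(2) by linarith
    \<comment> \<open>Within [0,1], a length above 1 - 1/q forces \<open>a i\<close> < 1/q and
      \<open>b i\<close> > 1 - 1/q, so the side contains the whole grid.\<close>
    then have "1 / real q \<le> x i" "x i \<le> 1 - 1 / real q"
      unfolding k(3) using k(1) q by (auto simp: field_simps)
    then show ?thesis using long bnd[OF i] by linarith
  qed
  then have "x \<in> open_box d a b" using xG unfolding open_box_def by (auto simp: PiE_iff)
  then show False using x(1) ab(3) by blast
qed

section \<open>The number of points needed\<close>

text \<open>By 1 - t \<le> exp(-t), with \<open>K = q\<^sup>2\<close> and \<open>m = q - 1\<close>,
  it suffices that n > m^K * K * ln(d m). The constant is chosen so that this survives replacing
  \<open>m\<close> by \<open>q\<close> and rounding down.\<close>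

lemma universal_set_size_bound:
  assumes q: "q \<ge> 4" and d: "d \<ge> 2"
  defines "n \<equiv> nat \<lfloor>real q ^ (q\<^sup>2 + 2) * (4 * ln (real q) + 1) * ln (real d)\<rfloor>"
  shows "real ((d * (q - 1)) ^ q\<^sup>2) * (1 - 1 / real (q - 1) ^ q\<^sup>2) ^ n < 1"
proof -
  define K where "K = q\<^sup>2"
  define c where "c = real q ^ (q\<^sup>2 + 2) * (4 * ln (real q) + 1) * ln (real d)"
  define m where "m = q - 1"
  have m: "1 \<le> m" "m \<le> q" using q unfolding m_def by auto
  have ln2: "1 / 2 \<le> ln (real d)"
  proof -
    have "1 / 2 \<le> ln (2::real)" using ln_le_minus_one[of "1 / 2"] by (simp add: ln_div)
    also have "\<dots> \<le> ln (real d)" using d by simp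
    finally show ?thesis .
  qed
  have "exp 1 \<le> (3::real)" by (rule exp_le)
  then have lnq: "1 \<le> ln (real q)"
    using q ln_ge_iff[of "real q" 1] by simp
  have K1: "1 \<le> real K" unfolding K_def using q by simp
  have qK: "1 \<le> real q ^ K * real K"
    using q K1 mult_mono[of 1 "real q ^ K" 1 "real K"] by simp
  have "c = real q ^ K * real K * (ln (real d) + 4 * ln (real q) * ln (real d))"
    unfolding c_def K_def by (simp add: power_add power2_eq_square algebra_simps)
  \<comment> \<open>From ln d \<ge> 1/2 and ln q \<ge> 1 follows 4 ln q ln d \<ge> 2 ln q \<ge> ln q
    + 1. The spare 1, multiplied by a factor of at least 1, pays for the floor in
    \<open>n\<close>.\<close>
  also have "\<dots> \<ge> real q ^ K * real K * (ln (real d) + ln (real q) + 1)"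
  proof (rule mult_left_mono)
    have "ln (real q) * 2 \<le> ln (real q) * (4 * ln (real d))"
      using lnq ln2 by (intro mult_left_mono) auto
    also have "\<dots> = 4 * ln (real q) * ln (real d)" by simp
    finally show "ln (real d) + ln (real q) + 1 \<le> ln (real d) + 4 * ln (real q) * ln (real d)"
      using lnq by linarith
  qed simp
  finally have c: "real q ^ K * real K * (ln (real d) + ln (real q)) + 1 \<le> c"
    using qK by (simp add: algebra_simps)
  have "real m ^ K * (real K * ln (real (d * m)))
      \<le> real q ^ K * (real K * (ln (real d) + ln (real q)))"
    using m d q by (intro mult_mono power_mono) (auto simp: ln_mult intro!: mult_nonneg_nonneg)
  also have "\<dots> \<le> c - 1" using c by (simp add: algebra_simps)
  also have "\<dots> < real n"
    unfolding n_def c_def[symmetric] by linarith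
  finally have n: "real K * ln (real (d * m)) < real n / real m ^ K"
    using m by (simp add: pos_less_divide_eq mult.commute)
  have "(1 - 1 / real m ^ K) ^ n \<le> exp (- (1 / real m ^ K)) ^ n"
    using m exp_ge_add_one_self[of "- (1 / real m ^ K)"] by (intro power_mono) auto
  also have "\<dots> = exp (- (real n / real m ^ K))" by (simp flip: exp_of_nat_mult)
  finally have "real (d * m) ^ K * (1 - 1 / real m ^ K) ^ n
      \<le> real (d * m) ^ K * exp (- (real n / real m ^ K))"
    by (intro mult_left_mono) auto
  also have "\<dots> = exp (real K * ln (real (d * m)) - real n / real m ^ K)"
    using d m by (simp add: exp_diff exp_of_nat_mult exp_minus divide_inverse)
  also have "\<dots> < 1" using n by simp
  finally show ?thesis unfolding K_def m_def by simp
qed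

text \<open>The greedy set may have fewer points than its bound. As \<open>inv_min_disp\<close> is a
  least index, its actual cardinality can be used, without padding the set.\<close>

lemma inv_min_disp_le_card:
  assumes "d \<ge> 1" "T \<subseteq> unit_cube d" "finite T" "disp d T \<le> r"
  shows "inv_min_disp r d \<le> card T"
proof -
  have "min_disp (card T) d \<le> disp d T"
    unfolding min_disp_def using assms(2,3)
    by (intro cInf_lower min_disp_set_bdd_below[OF assms(1)]) blast
  then show ?thesis unfolding inv_min_disp_def using assms(4) by (intro Least_le) linarith
qed

lemma inv_min_disp_le_log:
  assumes q: "q \<ge> 4" "1 / real q \<le> r" and d: "d \<ge> 2"
  shows "real (inv_min_disp r d) \<le> real q ^ (q\<^sup>2 + 2) * (4 * ln (real q) + 1) * ln (real d)"
    (is "_ \<le> ?c")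
proof -
  have "finite (grid q)" "grid q \<noteq> {}" using q unfolding grid_def by auto
  then obtain T where T: "T \<subseteq> {..<d} \<rightarrow>\<^sub>E grid q" "finite T" "card T \<le> nat \<lfloor>?c\<rfloor>"
    and univ: "\<forall>s\<in>{..<q\<^sup>2} \<rightarrow> {..<d}. \<forall>w\<in>{..<d} \<rightarrow> grid q. \<exists>x\<in>T. \<forall>j<q\<^sup>2. x (s j) = w (s j)"
    using ex_universal_set[of "grid q" d "q\<^sup>2" "nat \<lfloor>?c\<rfloor>"] universal_set_size_bound[OF q(1) d]
    unfolding card_grid by blast
  have "disp d T \<le> 1 / real q"
    using d q T univ by (intro disp_universal_set_le) auto
  then have "disp d T \<le> r" using q(2) by linarith
  moreover have "T \<subseteq> unit_cube d"
  proof -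
    have "grid q \<subseteq> {0..1}" unfolding grid_def by auto
    then show ?thesis using T(1) PiE_mono[of "{..<d}" "\<lambda>_. grid q" "\<lambda>_. {0..1}"]
      unfolding unit_cube_def by blast
  qed
  ultimately have "inv_min_disp r d \<le> card T" using d T(2) by (intro inv_min_disp_le_card) auto
  then have "real (inv_min_disp r d) \<le> real (nat \<lfloor>?c\<rfloor>)" using T(3) by simp
  also have "\<dots> \<le> ?c" using q d by (intro of_nat_floor mult_nonneg_nonneg) auto
  finally show ?thesis .
qed

theorem theorem2:
  fixes r :: real
  assumes "0 < r" and "r \<le> 1 / 4"
  shows "(\<exists>c::real. \<forall>d::nat. d \<ge> 2 \<longrightarrow> real (inv_min_disp r d) \<le> c * ln (real d)) \<and>
         (let q = nat \<lceil>1 / r\<rceil>; c = real q ^ (q\<^sup>2 + 2) * (4 * ln (real q) + 1)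
          in \<forall>d::nat. d \<ge> 2 \<longrightarrow> real (inv_min_disp r d) \<le> c * ln (real d))"
proof -
  define q where "q = nat \<lceil>1 / r\<rceil>"
  \<comment> \<open>The bound on \<open>r\<close> gives \<open>q \<ge> 4\<close>, hence q > e and ln
    q \<ge> 1 in the size estimate.\<close>
  have "4 \<le> 1 / r" using assms by (simp add: field_simps)
  moreover have ge: "1 / r \<le> real q" unfolding q_def by linarith
  ultimately have "q \<ge> 4" by linarith
  moreover have "1 / real q \<le> r" using ge \<open>q \<ge> 4\<close> assms by (simp add: field_simps)
  ultimately have "\<forall>d\<ge>2. real (inv_min_disp r d)
      \<le> real q ^ (q\<^sup>2 + 2) * (4 * ln (real q) + 1) * ln (real d)"
    using inv_min_disp_le_log by blast
  then show ?thesis unfolding Let_def q_def by blast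
qed

end
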